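(* Let $\mathcal C$ be a left $H$-category. The category $(Mod\text{-}\mathcal C)_H^H$ of left $H$-equivariant right $\mathcal C$-modules is identical to $((Mod\text{-}\mathcal C)_H)^H$.
   Context: $K$ is a field and $H$ is a Hopf algebra over $K$ with comultiplication $\Delta(h)=\sum h_1\otimes h_2$, counit $\varepsilon$ and bijective antipode $S$. A left $H$-module category is a $K$-linear category $\mathcal A$ such that every $Hom_{\mathcal A}(X,Y)$ is a left $H$-module, $h(\mathrm{id}_X)=\varepsilon(h)\,\mathrm{id}_X$, and $h(fg)=\sum h_1(f)h_2(g)$ for all $h\in H$ and composable $g:X\to Y$, $f:Y\to Z$. A left $H$-category is a small left $H$-module category. For a left $H$-module category $\mathcal A$, $\mathcal A^H$ is the subcategory with the same objects and with morphisms those $f$ satisfying $h(f)=\varepsilon(h)f$ for all $h\in H$. A right $\mathcal C$-module is a $K$-linear functor $\mathcal C^{op}\to Vect_K$; these form $Mod\text{-}\mathcal C$. A left $H$-equivariant right $\mathcal C$-module is a right $\mathcal C$-module $\mathcal M$ with a left $H$-module structure on each $\mathcal M(X)$ such that $h(\mathcal M(f)(m))=\sum\mathcal M(h_2f)(h_1m)$ for all $h\in H$, $f\in Hom_{\mathcal C}(X,Y)$, $m\in\mathcal M(Y)$. $(Mod\text{-}\mathcal C)_H^H$ is the category of these, with morphisms the right $\mathcal C$-module morphisms $\eta$ such that every $\eta(X)$ is $H$-linear. $(Mod\text{-}\mathcal C)_H$ is the category with the same objects but with all right $\mathcal C$-module morphisms; it is a left $H$-module category via $(h\cdot\eta)(X)(m)=\sum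 h_1\eta(X)(S(h_2)m)$. *)

theory Defs
  imports "HOL-Algebra.Module"
begin

text \<open>
  Vector spaces over a field \<open>K\<close> are modules over \<open>K\<close> in the sense of \<^locale>\<open>module\<close>. The fields
  \<^const>\<open>mult\<close> and \<^const>\<open>one\<close> of a module record are meaningless unless the module is also
  declared to be a ring; they are set to \<^const>\<open>undefined\<close> in the modules constructed below.
\<close>

definition linear_map ::
    "('k, 'r) ring_scheme \<Rightarrow> ('k, 'v, 'a) module_scheme \<Rightarrow> ('k, 'w, 'b) module_scheme \<Rightarrow> ('v \<Rightarrow> 'w) \<Rightarrow> bool"
  where "linear_map K V W f \<longleftrightarrow>
    f \<in> carrier V \<rightarrow> carrier W \<and>
    (\<forall>x\<in>carrier V. \<forall>y\<in>carrier V. f (x \<oplus>\<^bsub>V\<^esub> y) = f x \<oplus>\<^bsub>W\<^esub> f y) \<and>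
    (\<forall>k\<in>carrier K. \<forall>x\<in>carrier V. f (k \<odot>\<^bsub>V\<^esub> x) = k \<odot>\<^bsub>W\<^esub> f x)"


section \<open>Tensor products\<close>

text \<open>
  The list \<open>[(v\<^sub>1, w\<^sub>1), \<dots>, (v\<^sub>n, w\<^sub>n)]\<close> stands for the formal sum of the \<open>v\<^sub>i \<otimes> w\<^sub>i\<close>. The tensor product
  is the free commutative monoid on the pairs modulo the congruence generated by bilinearity.
  Coefficients and negatives are not needed in formal sums, because \<open>k (v \<otimes> w) = (k v) \<otimes> w\<close>.
\<close>

inductive tensor_eq ::
    "('k, 'r) ring_scheme \<Rightarrow> ('k, 'v, 'a) module_scheme \<Rightarrow> ('k, 'w, 'b) module_scheme
      \<Rightarrow> ('v \<times> 'w) list \<Rightarrow> ('v \<times> 'w) list \<Rightarrow> bool"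
  for K V W where
    refl: "set s \<subseteq> carrier V \<times> carrier W \<Longrightarrow> tensor_eq K V W s s"
  | sym: "tensor_eq K V W s t \<Longrightarrow> tensor_eq K V W t s"
  | trans: "tensor_eq K V W s t \<Longrightarrow> tensor_eq K V W t u \<Longrightarrow> tensor_eq K V W s u"
  | append: "tensor_eq K V W s s' \<Longrightarrow> tensor_eq K V W t t' \<Longrightarrow> tensor_eq K V W (s @ t) (s' @ t')"
  | commute: "set s \<subseteq> carrier V \<times> carrier W \<Longrightarrow> set t \<subseteq> carrier V \<times> carrier W
      \<Longrightarrow> tensor_eq K V W (s @ t) (t @ s)"
  | zero: "w \<in> carrier W \<Longrightarrow> tensor_eq K V W [(\<zero>\<^bsub>V\<^esub>, w)] []"
  | add_left: "v \<in> carrier V \<Longrightarrow> v' \<in> carrier V \<Longrightarrow> w \<in> carrier W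
      \<Longrightarrow> tensor_eq K V W [(v \<oplus>\<^bsub>V\<^esub> v', w)] [(v, w), (v', w)]"
  | add_right: "v \<in> carrier V \<Longrightarrow> w \<in> carrier W \<Longrightarrow> w' \<in> carrier W
      \<Longrightarrow> tensor_eq K V W [(v, w \<oplus>\<^bsub>W\<^esub> w')] [(v, w), (v, w')]"
  | balanced: "k \<in> carrier K \<Longrightarrow> v \<in> carrier V \<Longrightarrow> w \<in> carrier W
      \<Longrightarrow> tensor_eq K V W [(k \<odot>\<^bsub>V\<^esub> v, w)] [(v, k \<odot>\<^bsub>W\<^esub> w)]"

definition tensor_class ::
    "('k, 'r) ring_scheme \<Rightarrow> ('k, 'v, 'a) module_scheme \<Rightarrow> ('k, 'w, 'b) module_scheme
      \<Rightarrow> ('v \<times> 'w) list \<Rightarrow> ('v \<times> 'w) list set"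
  where "tensor_class K V W s = {t. tensor_eq K V W s t}"

definition tensor_rep :: "('v \<times> 'w) list set \<Rightarrow> ('v \<times> 'w) list"
  where "tensor_rep x = (SOME s. s \<in> x)"

definition tensor ::
    "('k, 'r) ring_scheme \<Rightarrow> ('k, 'v, 'a) module_scheme \<Rightarrow> ('k, 'w, 'b) module_scheme
      \<Rightarrow> ('k, ('v \<times> 'w) list set) module"
  where "tensor K V W =
    \<lparr> carrier = tensor_class K V W ` {s. set s \<subseteq> carrier V \<times> carrier W},
      mult = undefined, one = undefined,
      zero = tensor_class K V W [],
      add = (\<lambda>x y. tensor_class K V W (tensor_rep x @ tensor_rep y)),
      smult = (\<lambda>k x. tensor_class K V W (map (\<lambda>(v, w). (k \<odot>\<^bsub>V\<^esub> v, w)) (tensor_rep x))) \<rparr>"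

definition pure_tensor ::
    "('k, 'r) ring_scheme \<Rightarrow> ('k, 'v, 'a) module_scheme \<Rightarrow> ('k, 'w, 'b) module_scheme
      \<Rightarrow> 'v \<Rightarrow> 'w \<Rightarrow> ('v \<times> 'w) list set"
  where "pure_tensor K V W v w = tensor_class K V W [(v, w)]"

text \<open>
  The value at \<open>x\<close> of the linear map from the tensor product to \<open>P\<close> induced by a bilinear map \<open>\<beta>\<close>;
  bilinearity of \<open>\<beta>\<close> makes it independent of the chosen representative of \<open>x\<close>.
\<close>

definition tensor_lift :: "('p, 'a) ring_scheme \<Rightarrow> ('v \<Rightarrow> 'w \<Rightarrow> 'p) \<Rightarrow> ('v \<times> 'w) list set \<Rightarrow> 'p"
  where "tensor_lift P \<beta> x = foldr (\<lambda>(v, w) p. \<beta> v w \<oplus>\<^bsub>P\<^esub> p) (tensor_rep x) \<zero>\<^bsub>P\<^esub>"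


section \<open>Hopf algebras and their modules\<close>

record ('k, 'h) hopf_algebra = "('k, 'h) module" +
  comult :: "'h \<Rightarrow> ('h \<times> 'h) list set"
  counit :: "'h \<Rightarrow> 'k"
  antipode :: "'h \<Rightarrow> 'h"

text \<open>\<open>sweedler H P \<beta> h\<close> is the element \<open>\<Sum> \<beta>(h\<^sub>1, h\<^sub>2)\<close> of \<open>P\<close>.\<close>

definition sweedler ::
    "('k, 'h, 'a) hopf_algebra_scheme \<Rightarrow> ('p, 'b) ring_scheme \<Rightarrow> ('h \<Rightarrow> 'h \<Rightarrow> 'p) \<Rightarrow> 'h \<Rightarrow> 'p"
  where "sweedler H P \<beta> h = tensor_lift P \<beta> (comult H h)"

locale hopf_algebra = K: field K + H: ring H + module K H
  for K :: "('k, 'r) ring_scheme" and H :: "('k, 'h, 'a) hopf_algebra_scheme" +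
  assumes smult_mult_left: "\<lbrakk>k \<in> carrier K; x \<in> carrier H; y \<in> carrier H\<rbrakk>
      \<Longrightarrow> (k \<odot>\<^bsub>H\<^esub> x) \<otimes>\<^bsub>H\<^esub> y = k \<odot>\<^bsub>H\<^esub> (x \<otimes>\<^bsub>H\<^esub> y)"
    and smult_mult_right: "\<lbrakk>k \<in> carrier K; x \<in> carrier H; y \<in> carrier H\<rbrakk>
      \<Longrightarrow> x \<otimes>\<^bsub>H\<^esub> (k \<odot>\<^bsub>H\<^esub> y) = k \<odot>\<^bsub>H\<^esub> (x \<otimes>\<^bsub>H\<^esub> y)"
    and comult_linear: "linear_map K H (tensor K H H) (comult H)"
    and comult_one: "comult H \<one>\<^bsub>H\<^esub> = pure_tensor K H H \<one>\<^bsub>H\<^esub> \<one>\<^bsub>H\<^esub>"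
    \<comment> \<open>\<open>\<Delta>(xy) = \<Sum> x\<^sub>1y\<^sub>1 \<otimes> x\<^sub>2y\<^sub>2\<close>\<close>
    and comult_mult: "\<lbrakk>x \<in> carrier H; y \<in> carrier H\<rbrakk> \<Longrightarrow>
      comult H (x \<otimes>\<^bsub>H\<^esub> y) =
        sweedler H (tensor K H H) (\<lambda>a b.
          sweedler H (tensor K H H) (\<lambda>c d. pure_tensor K H H (a \<otimes>\<^bsub>H\<^esub> c) (b \<otimes>\<^bsub>H\<^esub> d)) y) x"
    and counit_closed: "h \<in> carrier H \<Longrightarrow> counit H h \<in> carrier K"
    and counit_add: "\<lbrakk>x \<in> carrier H; y \<in> carrier H\<rbrakk>
      \<Longrightarrow> counit H (x \<oplus>\<^bsub>H\<^esub> y) = counit H x \<oplus>\<^bsub>K\<^esub> counit H y"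
    and counit_smult: "\<lbrakk>k \<in> carrier K; x \<in> carrier H\<rbrakk>
      \<Longrightarrow> counit H (k \<odot>\<^bsub>H\<^esub> x) = k \<otimes>\<^bsub>K\<^esub> counit H x"
    and counit_one: "counit H \<one>\<^bsub>H\<^esub> = \<one>\<^bsub>K\<^esub>"
    and counit_mult: "\<lbrakk>x \<in> carrier H; y \<in> carrier H\<rbrakk>
      \<Longrightarrow> counit H (x \<otimes>\<^bsub>H\<^esub> y) = counit H x \<otimes>\<^bsub>K\<^esub> counit H y"
    \<comment> \<open>\<open>\<Sum> h\<^sub>1\<^sub>1 \<otimes> (h\<^sub>1\<^sub>2 \<otimes> h\<^sub>2) = \<Sum> h\<^sub>1 \<otimes> \<Delta>(h\<^sub>2)\<close>\<close>
    and coassoc: "h \<in> carrier H \<Longrightarrow>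
      sweedler H (tensor K H (tensor K H H)) (\<lambda>a b.
        sweedler H (tensor K H (tensor K H H)) (\<lambda>c d.
          pure_tensor K H (tensor K H H) c (pure_tensor K H H d b)) a) h =
      sweedler H (tensor K H (tensor K H H)) (\<lambda>a b.
        pure_tensor K H (tensor K H H) a (comult H b)) h"
    and counit_left: "h \<in> carrier H \<Longrightarrow> sweedler H H (\<lambda>a b. counit H a \<odot>\<^bsub>H\<^esub> b) h = h"
    and counit_right: "h \<in> carrier H \<Longrightarrow> sweedler H H (\<lambda>a b. counit H b \<odot>\<^bsub>H\<^esub> a) h = h"
    and antipode_linear: "linear_map K H H (antipode H)"
    and antipode_left: "h \<in> carrier H \<Longrightarrow>
      sweedler H H (\<lambda>a b. antipode H a \<otimes>\<^bsub>H\<^esub> b) h = counit H h \<odot>\<^bsub>H\<^esub> \<one>\<^bsub>H\<^esub>"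
    and antipode_right: "h \<in> carrier H \<Longrightarrow>
      sweedler H H (\<lambda>a b. a \<otimes>\<^bsub>H\<^esub> antipode H b) h = counit H h \<odot>\<^bsub>H\<^esub> \<one>\<^bsub>H\<^esub>"
    and antipode_bij: "bij_betw (antipode H) (carrier H) (carrier H)"

locale left_H_module = module K V
  for K :: "('k, 'r) ring_scheme" and H :: "('k, 'h, 'a) module_scheme"
    and V :: "('k, 'v, 'b) module_scheme" and act :: "'h \<Rightarrow> 'v \<Rightarrow> 'v" +
  assumes act_linear: "h \<in> carrier H \<Longrightarrow> linear_map K V V (act h)"
    and act_linear_left: "v \<in> carrier V \<Longrightarrow> linear_map K H V (\<lambda>h. act h v)"
    and act_one: "v \<in> carrier V \<Longrightarrow> act \<one>\<^bsub>H\<^esub> v = v"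
    and act_mult: "\<lbrakk>g \<in> carrier H; h \<in> carrier H; v \<in> carrier V\<rbrakk>
      \<Longrightarrow> act (g \<otimes>\<^bsub>H\<^esub> h) v = act g (act h v)"


section \<open>Linear categories and functors\<close>

text \<open>
  \<open>Comp C X Y Z g f\<close> is the composite of \<open>f : X \<rightarrow> Y\<close> and \<open>g : Y \<rightarrow> Z\<close>. It takes the objects as
  arguments because the sets of morphisms are not required to be disjoint.
\<close>

record ('k, 'o, 'm) lincat =
  Obj :: "'o set"
  Hom :: "'o \<Rightarrow> 'o \<Rightarrow> ('k, 'm) module"
  Comp :: "'o \<Rightarrow> 'o \<Rightarrow> 'o \<Rightarrow> 'm \<Rightarrow> 'm \<Rightarrow> 'm"
  Ident :: "'o \<Rightarrow> 'm"

locale linear_category =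
  fixes K :: "('k, 'r) ring_scheme" and C :: "('k, 'o, 'm, 'a) lincat_scheme"
  assumes Hom_module: "\<lbrakk>X \<in> Obj C; Y \<in> Obj C\<rbrakk> \<Longrightarrow> module K (Hom C X Y)"
    and Comp_linear_right: "\<lbrakk>X \<in> Obj C; Y \<in> Obj C; Z \<in> Obj C; g \<in> carrier (Hom C Y Z)\<rbrakk>
      \<Longrightarrow> linear_map K (Hom C X Y) (Hom C X Z) (\<lambda>f. Comp C X Y Z g f)"
    and Comp_linear_left: "\<lbrakk>X \<in> Obj C; Y \<in> Obj C; Z \<in> Obj C; f \<in> carrier (Hom C X Y)\<rbrakk>
      \<Longrightarrow> linear_map K (Hom C Y Z) (Hom C X Z) (\<lambda>g. Comp C X Y Z g f)"
    and Comp_assoc: "\<lbrakk>W \<in> Obj C; X \<in> Obj C; Y \<in> Obj C; Z \<in> Obj C;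
        f \<in> carrier (Hom C W X); g \<in> carrier (Hom C X Y); h \<in> carrier (Hom C Y Z)\<rbrakk>
      \<Longrightarrow> Comp C W X Z (Comp C X Y Z h g) f = Comp C W Y Z h (Comp C W X Y g f)"
    and Ident_closed: "X \<in> Obj C \<Longrightarrow> Ident C X \<in> carrier (Hom C X X)"
    and Ident_left: "\<lbrakk>X \<in> Obj C; Y \<in> Obj C; f \<in> carrier (Hom C X Y)\<rbrakk>
      \<Longrightarrow> Comp C X Y Y (Ident C Y) f = f"
    and Ident_right: "\<lbrakk>X \<in> Obj C; Y \<in> Obj C; f \<in> carrier (Hom C X Y)\<rbrakk>
      \<Longrightarrow> Comp C X X Y f (Ident C X) = f"

definition opposite :: "('k, 'o, 'm, 'a) lincat_scheme \<Rightarrow> ('k, 'o, 'm) lincat"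
  where "opposite C =
    \<lparr> Obj = Obj C,
      Hom = (\<lambda>X Y. Hom C Y X),
      Comp = (\<lambda>X Y Z g f. Comp C Z Y X f g),
      Ident = Ident C \<rparr>"

definition linear_Hom ::
    "('k, 'r) ring_scheme \<Rightarrow> ('k, 'v) module \<Rightarrow> ('k, 'v) module \<Rightarrow> ('k, 'v \<Rightarrow> 'v) module"
  where "linear_Hom K V W =
    \<lparr> carrier = {f \<in> extensional (carrier V). linear_map K V W f},
      mult = undefined, one = undefined,
      zero = (\<lambda>x\<in>carrier V. \<zero>\<^bsub>W\<^esub>),
      add = (\<lambda>f g. \<lambda>x\<in>carrier V. f x \<oplus>\<^bsub>W\<^esub> g x),
      smult = (\<lambda>k f. \<lambda>x\<in>carrier V. k \<odot>\<^bsub>W\<^esub> f x) \<rparr>"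

text \<open>The type \<open>'v\<close>, from which the underlying sets of the vector spaces are taken, is the universe.\<close>

definition Vect :: "('k, 'r) ring_scheme \<Rightarrow> ('k, ('k, 'v) module, 'v \<Rightarrow> 'v) lincat"
  where "Vect K =
    \<lparr> Obj = {V. module K V},
      Hom = linear_Hom K,
      Comp = (\<lambda>U V W g f. compose (carrier U) g f),
      Ident = (\<lambda>V. \<lambda>x\<in>carrier V. x) \<rparr>"

record ('o, 'm, 'p, 'n) lfunctor =
  FObj :: "'o \<Rightarrow> 'p"
  FMor :: "'o \<Rightarrow> 'o \<Rightarrow> 'm \<Rightarrow> 'n"

locale linear_functor =
  fixes K :: "('k, 'r) ring_scheme" and C :: "('k, 'o, 'm, 'a) lincat_scheme"
    and D :: "('k, 'p, 'n, 'b) lincat_scheme" and F :: "('o, 'm, 'p, 'n, 'c) lfunctor_scheme"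
  assumes FObj_closed: "X \<in> Obj C \<Longrightarrow> FObj F X \<in> Obj D"
    and FMor_linear: "\<lbrakk>X \<in> Obj C; Y \<in> Obj C\<rbrakk>
      \<Longrightarrow> linear_map K (Hom C X Y) (Hom D (FObj F X) (FObj F Y)) (FMor F X Y)"
    and FMor_Ident: "X \<in> Obj C \<Longrightarrow> FMor F X X (Ident C X) = Ident D (FObj F X)"
    and FMor_Comp: "\<lbrakk>X \<in> Obj C; Y \<in> Obj C; Z \<in> Obj C;
        f \<in> carrier (Hom C X Y); g \<in> carrier (Hom C Y Z)\<rbrakk>
      \<Longrightarrow> FMor F X Z (Comp C X Y Z g f) =
          Comp D (FObj F X) (FObj F Y) (FObj F Z) (FMor F Y Z g) (FMor F X Y f)"


section \<open>Module categories over a Hopf algebra and their invariants\<close>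

record ('k, 'h, 'o, 'm) hmodcat = "('k, 'o, 'm) lincat" +
  Act :: "'o \<Rightarrow> 'o \<Rightarrow> 'h \<Rightarrow> 'm \<Rightarrow> 'm"

locale left_H_module_category = linear_category K A
  for K :: "('k, 'r) ring_scheme" and H :: "('k, 'h, 'a) hopf_algebra_scheme"
    and A :: "('k, 'h, 'o, 'm, 'b) hmodcat_scheme" +
  assumes Hom_H_module: "\<lbrakk>X \<in> Obj A; Y \<in> Obj A\<rbrakk> \<Longrightarrow> left_H_module K H (Hom A X Y) (Act A X Y)"
    and Act_Ident: "\<lbrakk>X \<in> Obj A; h \<in> carrier H\<rbrakk>
      \<Longrightarrow> Act A X X h (Ident A X) = counit H h \<odot>\<^bsub>Hom A X X\<^esub> Ident A X"
    and Act_Comp: "\<lbrakk>X \<in> Obj A; Y \<in> Obj A; Z \<in> Obj A; h \<in> carrier H;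
        g \<in> carrier (Hom A X Y); f \<in> carrier (Hom A Y Z)\<rbrakk>
      \<Longrightarrow> Act A X Z h (Comp A X Y Z f g) =
          sweedler H (Hom A X Z) (\<lambda>a b. Comp A X Y Z (Act A Y Z a f) (Act A X Y b g)) h"

text \<open>Smallness is automatic here, because the objects form a set of a HOL type.\<close>

abbreviation left_H_category ::
    "('k, 'r) ring_scheme \<Rightarrow> ('k, 'h, 'a) hopf_algebra_scheme \<Rightarrow> ('k, 'h, 'o, 'm, 'b) hmodcat_scheme \<Rightarrow> bool"
  where "left_H_category \<equiv> left_H_module_category"

definition invariants ::
    "('k, 'h, 'a) hopf_algebra_scheme \<Rightarrow> ('k, 'h, 'o, 'm, 'b) hmodcat_scheme \<Rightarrow> ('k, 'o, 'm) lincat"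
  where "invariants H A =
    \<lparr> Obj = Obj A,
      Hom = (\<lambda>X Y. (Hom A X Y)\<lparr> carrier :=
        {f \<in> carrier (Hom A X Y). \<forall>h\<in>carrier H. Act A X Y h f = counit H h \<odot>\<^bsub>Hom A X Y\<^esub> f} \<rparr>),
      Comp = Comp A,
      Ident = Ident A \<rparr>"


section \<open>Equivariant modules\<close>

abbreviation right_module ::
    "('k, 'r) ring_scheme \<Rightarrow> ('k, 'o, 'm, 'a) lincat_scheme
      \<Rightarrow> ('o, 'm, ('k, 'v) module, 'v \<Rightarrow> 'v, 'b) lfunctor_scheme \<Rightarrow> bool"
  where "right_module K C M \<equiv> linear_functor K (opposite C) (Vect K) M"

text \<open>
  For \<open>f : X \<rightarrow> Y\<close> in \<open>C\<close> and a right module \<open>M\<close>, the map \<open>M(f) : M(Y) \<rightarrow> M(X)\<close> is \<open>FMor M Y X f\<close>,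
  as \<open>f\<close> is a morphism from \<open>Y\<close> to \<open>X\<close> in the opposite category.
\<close>

definition right_module_morphisms ::
    "('k, 'r) ring_scheme \<Rightarrow> ('k, 'o, 'm, 'a) lincat_scheme
      \<Rightarrow> ('o, 'm, ('k, 'v) module, 'v \<Rightarrow> 'v, 'b) lfunctor_scheme
      \<Rightarrow> ('o, 'm, ('k, 'v) module, 'v \<Rightarrow> 'v, 'c) lfunctor_scheme \<Rightarrow> ('o \<Rightarrow> 'v \<Rightarrow> 'v) set"
  where "right_module_morphisms K C M N =
    {\<eta> \<in> Pi\<^sub>E (Obj C) (\<lambda>X. carrier (linear_Hom K (FObj M X) (FObj N X))).
      \<forall>X\<in>Obj C. \<forall>Y\<in>Obj C. \<forall>f\<in>carrier (Hom C X Y). \<forall>m\<in>carrier (FObj M Y).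
        \<eta> X (FMor M Y X f m) = FMor N Y X f (\<eta> Y m)}"

definition right_module_Hom ::
    "('k, 'r) ring_scheme \<Rightarrow> ('k, 'o, 'm, 'a) lincat_scheme
      \<Rightarrow> ('o, 'm, ('k, 'v) module, 'v \<Rightarrow> 'v, 'b) lfunctor_scheme
      \<Rightarrow> ('o, 'm, ('k, 'v) module, 'v \<Rightarrow> 'v, 'c) lfunctor_scheme \<Rightarrow> ('k, 'o \<Rightarrow> 'v \<Rightarrow> 'v) module"
  where "right_module_Hom K C M N =
    \<lparr> carrier = right_module_morphisms K C M N,
      mult = undefined, one = undefined,
      zero = (\<lambda>X\<in>Obj C. \<zero>\<^bsub>linear_Hom K (FObj M X) (FObj N X)\<^esub>),
      add = (\<lambda>\<eta> \<theta>. \<lambda>X\<in>Obj C. \<eta> X \<oplus>\<^bsub>linear_Hom K (FObj M X) (FObj N X)\<^esub> \<theta> X),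
      smult = (\<lambda>k \<eta>. \<lambda>X\<in>Obj C. k \<odot>\<^bsub>linear_Hom K (FObj M X) (FObj N X)\<^esub> \<eta> X) \<rparr>"

record ('k, 'h, 'o, 'm, 'v) eqmod = "('o, 'm, ('k, 'v) module, 'v \<Rightarrow> 'v) lfunctor" +
  HAct :: "'o \<Rightarrow> 'h \<Rightarrow> 'v \<Rightarrow> 'v"

locale equivariant_module = linear_functor K "opposite C" "Vect K" M
  for K :: "('k, 'r) ring_scheme" and H :: "('k, 'h, 'a) hopf_algebra_scheme"
    and C :: "('k, 'h, 'o, 'm, 'b) hmodcat_scheme" and M :: "('k, 'h, 'o, 'm, 'v) eqmod" +
  assumes HAct_module: "X \<in> Obj C \<Longrightarrow> left_H_module K H (FObj M X) (HAct M X)"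
    and equivariant: "\<lbrakk>X \<in> Obj C; Y \<in> Obj C; h \<in> carrier H;
        f \<in> carrier (Hom C X Y); m \<in> carrier (FObj M Y)\<rbrakk>
      \<Longrightarrow> HAct M X h (FMor M Y X f m) =
          sweedler H (FObj M X) (\<lambda>a b. FMor M Y X (Act C X Y b f) (HAct M Y a m)) h"

text \<open>The category \<open>(Mod-C)\<^sub>H\<close>; the action is \<open>(h \<cdot> \<eta>)(X)(m) = \<Sum> h\<^sub>1 \<eta>(X)(S(h\<^sub>2) m)\<close>.\<close>

definition Mod_H ::
    "('k, 'r) ring_scheme \<Rightarrow> ('k, 'h, 'a) hopf_algebra_scheme \<Rightarrow> ('k, 'h, 'o, 'm, 'b) hmodcat_scheme
      \<Rightarrow> ('k, 'h, ('k, 'h, 'o, 'm, 'v) eqmod, 'o \<Rightarrow> 'v \<Rightarrow> 'v) hmodcat"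
  where "Mod_H K H C =
    \<lparr> Obj = {M. equivariant_module K H C M},
      Hom = right_module_Hom K C,
      Comp = (\<lambda>L M N \<theta> \<eta>. \<lambda>X\<in>Obj C. compose (carrier (FObj L X)) (\<theta> X) (\<eta> X)),
      Ident = (\<lambda>M. \<lambda>X\<in>Obj C. \<lambda>m\<in>carrier (FObj M X). m),
      Act = (\<lambda>M N h \<eta>. \<lambda>X\<in>Obj C. \<lambda>m\<in>carrier (FObj M X).
        sweedler H (FObj N X) (\<lambda>a b. HAct N X a (\<eta> X (HAct M X (antipode H b) m))) h) \<rparr>"

text \<open>The category \<open>(Mod-C)\<^sub>H\<^sup>H\<close>, whose morphisms are the objectwise \<open>H\<close>-linear ones.\<close>

definition Mod_HH ::
    "('k, 'r) ring_scheme \<Rightarrow> ('k, 'h, 'a) hopf_algebra_scheme \<Rightarrow> ('k, 'h, 'o, 'm, 'b) hmodcat_scheme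
      \<Rightarrow> ('k, ('k, 'h, 'o, 'm, 'v) eqmod, 'o \<Rightarrow> 'v \<Rightarrow> 'v) lincat"
  where "Mod_HH K H C =
    \<lparr> Obj = {M. equivariant_module K H C M},
      Hom = (\<lambda>M N. (right_module_Hom K C M N)\<lparr> carrier :=
        {\<eta> \<in> right_module_morphisms K C M N.
          \<forall>X\<in>Obj C. \<forall>h\<in>carrier H. \<forall>m\<in>carrier (FObj M X).
            \<eta> X (HAct M X h m) = HAct N X h (\<eta> X m)} \<rparr>),
      Comp = (\<lambda>L M N \<theta> \<eta>. \<lambda>X\<in>Obj C. compose (carrier (FObj L X)) (\<theta> X) (\<eta> X)),
      Ident = (\<lambda>M. \<lambda>X\<in>Obj C. \<lambda>m\<in>carrier (FObj M X). m) \<rparr>"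


section \<open>Identity of linear categories\<close>

text \<open>
  Equality of all the data, disregarding the values that the total functions of HOL take outside
  the objects, the sets of morphisms and the scalars (where \<open>=\<close> on records would compare them too).
\<close>

definition identical_modules ::
    "('k, 'r) ring_scheme \<Rightarrow> ('k, 'v, 'a) module_scheme \<Rightarrow> ('k, 'v, 'b) module_scheme \<Rightarrow> bool"
  where "identical_modules K V W \<longleftrightarrow>
    carrier V = carrier W \<and> \<zero>\<^bsub>V\<^esub> = \<zero>\<^bsub>W\<^esub> \<and>
    (\<forall>x\<in>carrier V. \<forall>y\<in>carrier V. x \<oplus>\<^bsub>V\<^esub> y = x \<oplus>\<^bsub>W\<^esub> y) \<and>
    (\<forall>k\<in>carrier K. \<forall>x\<in>carrier V. k \<odot>\<^bsub>V\<^esub> x = k \<odot>\<^bsub>W\<^esub> x)"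

definition identical_categories ::
    "('k, 'r) ring_scheme \<Rightarrow> ('k, 'o, 'm, 'a) lincat_scheme \<Rightarrow> ('k, 'o, 'm, 'b) lincat_scheme \<Rightarrow> bool"
  where "identical_categories K C D \<longleftrightarrow>
    Obj C = Obj D \<and>
    (\<forall>X\<in>Obj C. \<forall>Y\<in>Obj C. identical_modules K (Hom C X Y) (Hom D X Y)) \<and>
    (\<forall>X\<in>Obj C. \<forall>Y\<in>Obj C. \<forall>Z\<in>Obj C. \<forall>f\<in>carrier (Hom C X Y). \<forall>g\<in>carrier (Hom C Y Z).
      Comp C X Y Z g f = Comp D X Y Z g f) \<and>
    (\<forall>X\<in>Obj C. Ident C X = Ident D X)"

end

theory Submission
  imports Defs
begin

text \<open>
  Only the sets of morphisms have to be compared, and this can be done at each object separately.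
  Let \<open>f : V \<rightarrow> W\<close> be a linear map of \<open>H\<close>-modules. If \<open>f\<close> is \<open>H\<close>-linear then
  \<open>(h \<cdot> f)(m) = \<Sum> h\<^sub>1 S(h\<^sub>2) f(m) = \<epsilon>(h) f(m)\<close>. Conversely, if \<open>f\<close> is invariant then
  \<open>h f(m) = \<Sum> h\<^sub>1 f(S(h\<^sub>2) h\<^sub>3 m) = \<Sum> (h\<^sub>1 \<cdot> f)(h\<^sub>2 m) = \<Sum> \<epsilon>(h\<^sub>1) f(h\<^sub>2 m) = f(h m)\<close>,
  where coassociativity is applied to the trilinear map \<open>(x, y, z) \<mapsto> x f(S(y) z m)\<close>.
\<close>

section \<open>Formal sums, and the maps that balanced maps induce on tensor products\<close>

section \<open>Balanced maps and tensor products\<close>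

text \<open>\<open>tensor_lift\<close> folds over the chosen representative of a class only. The
  same fold on an arbitrary list admits induction and lets two representatives be compared.\<close>

definition tensor_sum :: "('p, 'a) ring_scheme \<Rightarrow> ('v \<Rightarrow> 'w \<Rightarrow> 'p) \<Rightarrow> ('v \<times> 'w) list \<Rightarrow> 'p"
  where "tensor_sum P \<beta> s = foldr (\<lambda>(v, w) p. \<beta> v w \<oplus>\<^bsub>P\<^esub> p) s \<zero>\<^bsub>P\<^esub>"

lemma tensor_sum_Nil [simp]: "tensor_sum P \<beta> [] = \<zero>\<^bsub>P\<^esub>"
  and tensor_sum_Cons [simp]: "tensor_sum P \<beta> ((v, w) # s) = \<beta> v w \<oplus>\<^bsub>P\<^esub> tensor_sum P \<beta> s"
  by (simp_all add: tensor_sum_def)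

lemma tensor_lift_eq: "tensor_lift P \<beta> x = tensor_sum P \<beta> (tensor_rep x)"
  by (simp add: tensor_lift_def tensor_sum_def)

lemma tensor_sum_cong:
  assumes "set s \<subseteq> A \<times> B" and "\<And>v w. v \<in> A \<Longrightarrow> w \<in> B \<Longrightarrow> \<beta> v w = \<gamma> v w"
  shows "tensor_sum P \<beta> s = tensor_sum P \<gamma> s"
  using assms(1) by (induction s) (auto simp: assms(2))

lemma tensor_sum_closed:
  assumes "set s \<subseteq> A \<times> B" and "\<And>v w. v \<in> A \<Longrightarrow> w \<in> B \<Longrightarrow> \<beta> v w \<in> carrier P"
    and "\<zero>\<^bsub>P\<^esub> \<in> carrier P" and "\<And>x y. x \<in> carrier P \<Longrightarrow> y \<in> carrier P \<Longrightarrow> x \<oplus>\<^bsub>P\<^esub> y \<in> carrier P"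
  shows "tensor_sum P \<beta> s \<in> carrier P"
  using assms(1) by (induction s) (auto simp: assms(2-))

text \<open>About \<open>P\<close> only closure of its operations is assumed, so that
  \<open>P\<close> may be an iterated tensor product, for which closure is what is established
  below.\<close>

lemma tensor_sum_image:
  assumes "set s \<subseteq> A \<times> B" and "\<And>v w. v \<in> A \<Longrightarrow> w \<in> B \<Longrightarrow> \<beta> v w \<in> carrier P"
    and "\<zero>\<^bsub>P\<^esub> \<in> carrier P" and "\<And>x y. x \<in> carrier P \<Longrightarrow> y \<in> carrier P \<Longrightarrow> x \<oplus>\<^bsub>P\<^esub> y \<in> carrier P"
    and "f \<zero>\<^bsub>P\<^esub> = \<zero>\<^bsub>Q\<^esub>"
    and "\<And>x y. x \<in> carrier P \<Longrightarrow> y \<in> carrier P \<Longrightarrow> f (x \<oplus>\<^bsub>P\<^esub> y) = f x \<oplus>\<^bsub>Q\<^esub> f y"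
  shows "f (tensor_sum P \<beta> s) = tensor_sum Q (\<lambda>v w. f (\<beta> v w)) s"
  using assms(1)
proof (induction s)
  case Nil
  then show ?case by (simp add: assms(5))
next
  case (Cons p s)
  obtain v w where p: "p = (v, w)" by fastforce
  have "tensor_sum P \<beta> s \<in> carrier P"
    using Cons.prems assms(2-4) by (intro tensor_sum_closed[where A = A and B = B]) auto
  then show ?case
    using Cons by (simp add: p assms(2) assms(6))
qed

lemma (in abelian_group) tensor_sum_append:
  assumes "set s \<subseteq> A \<times> B" "set t \<subseteq> A \<times> B" and "\<And>v w. v \<in> A \<Longrightarrow> w \<in> B \<Longrightarrow> \<beta> v w \<in> carrier G"
  shows "tensor_sum G \<beta> (s @ t) = tensor_sum G \<beta> s \<oplus> tensor_sum G \<beta> t"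
  using assms(1)
proof (induction s)
  case Nil
  then show ?case
    using assms(2,3) by (simp add: tensor_sum_closed[where A = A and B = B])
next
  case (Cons p s)
  obtain v w where p: "p = (v, w)" by fastforce
  have "tensor_sum G \<beta> s \<in> carrier G" "tensor_sum G \<beta> t \<in> carrier G"
    using Cons.prems assms(2,3) by (auto intro!: tensor_sum_closed[where A = A and B = B])
  then show ?case
    using Cons by (simp add: p assms(3) a_assoc)
qed

text \<open>Serves maps depending additively on a further variable: two such sums over one and the
  same list can be merged by commutativity.\<close>

lemma (in abelian_group) tensor_sum_add:
  assumes "set s \<subseteq> A \<times> B"
    and "\<And>v w. v \<in> A \<Longrightarrow> w \<in> B \<Longrightarrow> \<beta> v w \<in> carrier G"
    and "\<And>v w. v \<in> A \<Longrightarrow> w \<in> B \<Longrightarrow> \<gamma> v w \<in> carrier G"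
  shows "tensor_sum G (\<lambda>v w. \<beta> v w \<oplus> \<gamma> v w) s = tensor_sum G \<beta> s \<oplus> tensor_sum G \<gamma> s"
  using assms(1)
proof (induction s)
  case (Cons p s)
  obtain v w where p: "p = (v, w)" by fastforce
  have "tensor_sum G \<beta> s \<in> carrier G" "tensor_sum G \<gamma> s \<in> carrier G"
    using Cons.prems assms(2,3) by (auto intro!: tensor_sum_closed[where A = A and B = B])
  then show ?case
    using Cons by (simp add: p assms(2,3) a_ac)
qed simp

text \<open>The fragment of the module axioms that passes to tensor products by a direct argument.
  It suffices to keep representatives inside the carriers and to form Sweedler sums.\<close>

locale closed_ops =
  fixes K :: "('k, 'r) ring_scheme" and V :: "('k, 'v, 'a) module_scheme"
  assumes zero_mem: "\<zero>\<^bsub>V\<^esub> \<in> carrier V"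
    and add_mem: "x \<in> carrier V \<Longrightarrow> y \<in> carrier V \<Longrightarrow> x \<oplus>\<^bsub>V\<^esub> y \<in> carrier V"
    and smult_mem: "k \<in> carrier K \<Longrightarrow> x \<in> carrier V \<Longrightarrow> k \<odot>\<^bsub>V\<^esub> x \<in> carrier V"

lemma (in module) closed_ops: "closed_ops R M"
  by unfold_locales auto

lemma tensor_eq_carrier:
  assumes "closed_ops K V" "closed_ops K W" and "tensor_eq K V W s t"
  shows "set s \<subseteq> carrier V \<times> carrier W \<and> set t \<subseteq> carrier V \<times> carrier W"
proof -
  interpret V: closed_ops K V by fact
  interpret W: closed_ops K W by fact
  show ?thesis using assms(3)
    by (induction rule: tensor_eq.induct)
      (auto simp: V.zero_mem V.add_mem V.smult_mem W.add_mem W.smult_mem)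
qed

text \<open>By reflexivity the class contains \<open>s\<close>, so the choice in
  \<open>tensor_rep\<close> is made from a nonempty set and returns a list equivalent to
  \<open>s\<close>.\<close>

lemma tensor_eq_rep:
  assumes "set s \<subseteq> carrier V \<times> carrier W"
  shows "tensor_eq K V W s (tensor_rep (tensor_class K V W s))"
  using someI[where P = "\<lambda>t. tensor_eq K V W s t", OF tensor_eq.refl[OF assms]]
  by (simp add: tensor_rep_def tensor_class_def)

lemma tensor_rep_carrier:
  assumes "closed_ops K V" "closed_ops K W" and "x \<in> carrier (tensor K V W)"
  shows "set (tensor_rep x) \<subseteq> carrier V \<times> carrier W"
proof -
  obtain s where "set s \<subseteq> carrier V \<times> carrier W" "x = tensor_class K V W s"
    using assms(3) by (auto simp: tensor_def)
  then show ?thesis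
    using tensor_eq_carrier[OF assms(1,2) tensor_eq_rep] by metis
qed

lemma tensor_class_closed:
  "set s \<subseteq> carrier V \<times> carrier W \<Longrightarrow> tensor_class K V W s \<in> carrier (tensor K V W)"
  by (simp add: tensor_def)

lemma pure_tensor_closed:
  "v \<in> carrier V \<Longrightarrow> w \<in> carrier W \<Longrightarrow> pure_tensor K V W v w \<in> carrier (tensor K V W)"
  unfolding pure_tensor_def by (rule tensor_class_closed) simp

lemma closed_ops_tensor:
  assumes V: "closed_ops K V" and W: "closed_ops K W"
  shows "closed_ops K (tensor K V W)"
proof
  show "\<zero>\<^bsub>tensor K V W\<^esub> \<in> carrier (tensor K V W)"
    using tensor_class_closed[of "[]"] by (simp add: tensor_def)
next
  fix x y
  assume "x \<in> carrier (tensor K V W)" "y \<in> carrier (tensor K V W)"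
  then have "tensor_class K V W (tensor_rep x @ tensor_rep y) \<in> carrier (tensor K V W)"
    using tensor_rep_carrier[OF V W] by (intro tensor_class_closed) (metis set_append Un_least)
  then show "x \<oplus>\<^bsub>tensor K V W\<^esub> y \<in> carrier (tensor K V W)"
    by (simp add: tensor_def)
next
  fix k x
  assume k: "k \<in> carrier K" and x: "x \<in> carrier (tensor K V W)"
  have "tensor_class K V W (map (\<lambda>(v, w). (k \<odot>\<^bsub>V\<^esub> v, w)) (tensor_rep x)) \<in> carrier (tensor K V W)"
    using tensor_rep_carrier[OF V W x] closed_ops.smult_mem[OF V k]
    by (intro tensor_class_closed) auto
  then show "k \<odot>\<^bsub>tensor K V W\<^esub> x \<in> carrier (tensor K V W)"
    by (simp add: tensor_def)
qed

text \<open>The last four assumptions mirror the generators \<open>add_left\<close>,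
  \<open>add_right\<close>, \<open>zero\<close> and \<open>balanced\<close> of
  \<open>tensor_eq\<close>. The target enters as an abelian group, and scalars only move between the
  two arguments.\<close>

locale balanced_map = P: abelian_group P + V: closed_ops K V + W: closed_ops K W
  for K :: "('k, 'r) ring_scheme" and V :: "('k, 'v, 'a) module_scheme"
    and W :: "('k, 'w, 'b) module_scheme" and P :: "('p, 'c) ring_scheme" and \<beta> :: "'v \<Rightarrow> 'w \<Rightarrow> 'p" +
  assumes closed: "v \<in> carrier V \<Longrightarrow> w \<in> carrier W \<Longrightarrow> \<beta> v w \<in> carrier P"
    and add_left: "\<lbrakk>v \<in> carrier V; v' \<in> carrier V; w \<in> carrier W\<rbrakk>
      \<Longrightarrow> \<beta> (v \<oplus>\<^bsub>V\<^esub> v') w = \<beta> v w \<oplus>\<^bsub>P\<^esub> \<beta> v' w"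
    and add_right: "\<lbrakk>v \<in> carrier V; w \<in> carrier W; w' \<in> carrier W\<rbrakk>
      \<Longrightarrow> \<beta> v (w \<oplus>\<^bsub>W\<^esub> w') = \<beta> v w \<oplus>\<^bsub>P\<^esub> \<beta> v w'"
    and zero_left: "w \<in> carrier W \<Longrightarrow> \<beta> \<zero>\<^bsub>V\<^esub> w = \<zero>\<^bsub>P\<^esub>"
    and balanced: "\<lbrakk>k \<in> carrier K; v \<in> carrier V; w \<in> carrier W\<rbrakk>
      \<Longrightarrow> \<beta> (k \<odot>\<^bsub>V\<^esub> v) w = \<beta> v (k \<odot>\<^bsub>W\<^esub> w)"
begin

lemma sum_closed:
  "set s \<subseteq> carrier V \<times> carrier W \<Longrightarrow> tensor_sum P \<beta> s \<in> carrier P"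
  by (rule tensor_sum_closed[where A = "carrier V" and B = "carrier W"]) (auto simp: closed)

lemma sum_append:
  "\<lbrakk>set s \<subseteq> carrier V \<times> carrier W; set t \<subseteq> carrier V \<times> carrier W\<rbrakk>
    \<Longrightarrow> tensor_sum P \<beta> (s @ t) = tensor_sum P \<beta> s \<oplus>\<^bsub>P\<^esub> tensor_sum P \<beta> t"
  by (rule P.tensor_sum_append[where A = "carrier V" and B = "carrier W"]) (auto simp: closed)

text \<open>Induction over the congruence: each bilinearity generator is an assumption of the
  locale, while concatenation and exchange of lists become addition and commutativity in
  \<open>P\<close>.\<close>

lemma sum_eq:
  assumes "tensor_eq K V W s t"
  shows "tensor_sum P \<beta> s = tensor_sum P \<beta> t"
  using assms
proof (induction rule: tensor_eq.induct)
  case (append s s' t t')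
  then show ?case
    using tensor_eq_carrier[OF V.closed_ops_axioms W.closed_ops_axioms] by (metis sum_append)
next
  case (commute s t)
  then show ?case
    using sum_closed[of s] sum_closed[of t] by (simp add: sum_append P.a_comm)
qed (simp_all add: closed V.add_mem V.smult_mem W.add_mem W.smult_mem add_left add_right
      zero_left balanced)

text \<open>Independence of the representative: the chosen list is equivalent to \<open>s\<close>,
  hence has the same sum.\<close>

lemma lift_class:
  "set s \<subseteq> carrier V \<times> carrier W \<Longrightarrow> tensor_lift P \<beta> (tensor_class K V W s) = tensor_sum P \<beta> s"
  unfolding tensor_lift_eq by (metis tensor_eq_rep sum_eq)

lemma lift_pure:
  "v \<in> carrier V \<Longrightarrow> w \<in> carrier W \<Longrightarrow> tensor_lift P \<beta> (pure_tensor K V W v w) = \<beta> v w"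
  by (simp add: pure_tensor_def lift_class closed)

lemma rep_carrier:
  "x \<in> carrier (tensor K V W) \<Longrightarrow> set (tensor_rep x) \<subseteq> carrier V \<times> carrier W"
  by (rule tensor_rep_carrier) unfold_locales

lemma lift_closed:
  "x \<in> carrier (tensor K V W) \<Longrightarrow> tensor_lift P \<beta> x \<in> carrier P"
  unfolding tensor_lift_eq by (intro sum_closed rep_carrier)

lemma lift_zero: "tensor_lift P \<beta> \<zero>\<^bsub>tensor K V W\<^esub> = \<zero>\<^bsub>P\<^esub>"
  using lift_class[of "[]"] by (simp add: tensor_def)

lemma lift_add:
  assumes "x \<in> carrier (tensor K V W)" "y \<in> carrier (tensor K V W)"
  shows "tensor_lift P \<beta> (x \<oplus>\<^bsub>tensor K V W\<^esub> y) = tensor_lift P \<beta> x \<oplus>\<^bsub>P\<^esub> tensor_lift P \<beta> y"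
proof -
  have "tensor_lift P \<beta> (x \<oplus>\<^bsub>tensor K V W\<^esub> y)
      = tensor_lift P \<beta> (tensor_class K V W (tensor_rep x @ tensor_rep y))"
    by (simp add: tensor_def)
  also have "\<dots> = tensor_sum P \<beta> (tensor_rep x @ tensor_rep y)"
    using assms[THEN rep_carrier] by (simp add: lift_class)
  also have "\<dots> = tensor_lift P \<beta> x \<oplus>\<^bsub>P\<^esub> tensor_lift P \<beta> y"
    unfolding tensor_lift_eq by (intro sum_append rep_carrier assms)
  finally show ?thesis .
qed

text \<open>As \<open>P\<close> has no scalar multiplication here, the scalar stays in the first
  argument of \<beta>. In this form it can be passed on to a third variable.\<close>

lemma lift_smult:
  assumes k: "k \<in> carrier K" and x: "x \<in> carrier (tensor K V W)"
  shows "tensor_lift P \<beta> (k \<odot>\<^bsub>tensor K V W\<^esub> x) = tensor_lift P (\<lambda>v w. \<beta> (k \<odot>\<^bsub>V\<^esub> v) w) x"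
proof -
  let ?s = "map (\<lambda>(v, w). (k \<odot>\<^bsub>V\<^esub> v, w)) (tensor_rep x)"
  have "set ?s \<subseteq> carrier V \<times> carrier W"
    using rep_carrier[OF x] V.smult_mem[OF k] by auto
  then have "tensor_lift P \<beta> (tensor_class K V W ?s) = tensor_sum P \<beta> ?s"
    by (rule lift_class)
  also have "\<dots> = tensor_lift P (\<lambda>v w. \<beta> (k \<odot>\<^bsub>V\<^esub> v) w) x"
    by (simp add: tensor_lift_eq tensor_sum_def foldr_map comp_def case_prod_unfold)
  finally show ?thesis by (simp add: tensor_def)
qed

end


section \<open>Sums over the comultiplication, and coassociativity evaluated on trilinear
  maps\<close>

section \<open>Sweedler sums\<close>

lemma linear_mapD:
  assumes "linear_map K V W f"
  shows "x \<in> carrier V \<Longrightarrow> f x \<in> carrier W"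
    and "x \<in> carrier V \<Longrightarrow> y \<in> carrier V \<Longrightarrow> f (x \<oplus>\<^bsub>V\<^esub> y) = f x \<oplus>\<^bsub>W\<^esub> f y"
    and "k \<in> carrier K \<Longrightarrow> x \<in> carrier V \<Longrightarrow> f (k \<odot>\<^bsub>V\<^esub> x) = k \<odot>\<^bsub>W\<^esub> f x"
  using assms by (auto simp: linear_map_def)

text \<open>Cancellation in \<open>Q\<close> applied to f(0) + f(0) = f(0). It derives the zero
  conditions of \<open>balanced_map\<close> and \<open>sweedler_image\<close> from
  additivity.\<close>

lemma (in abelian_group) additive_zero:
  assumes "abelian_group Q"
    and "\<And>x. x \<in> carrier G \<Longrightarrow> f x \<in> carrier Q"
    and "\<And>x y. x \<in> carrier G \<Longrightarrow> y \<in> carrier G \<Longrightarrow> f (x \<oplus> y) = f x \<oplus>\<^bsub>Q\<^esub> f y"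
  shows "f \<zero> = \<zero>\<^bsub>Q\<^esub>"
proof -
  interpret Q: abelian_group Q by fact
  have "f \<zero> \<oplus>\<^bsub>Q\<^esub> f \<zero> = f \<zero> \<oplus>\<^bsub>Q\<^esub> \<zero>\<^bsub>Q\<^esub>"
    using assms(3)[of \<zero> \<zero>] assms(2)[of \<zero>] by simp
  then show ?thesis
    using assms(2)[of \<zero>] by simp
qed

context hopf_algebra
begin

lemma H_closed_ops: "closed_ops K H"
  by (rule closed_ops)

lemma comult_closed: "h \<in> carrier H \<Longrightarrow> comult H h \<in> carrier (tensor K H H)"
  using comult_linear by (rule linear_mapD)

lemma comult_rep: "h \<in> carrier H \<Longrightarrow> set (tensor_rep (comult H h)) \<subseteq> carrier H \<times> carrier H"
  by (rule tensor_rep_carrier[OF H_closed_ops H_closed_ops comult_closed])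

lemma antipode_closed: "h \<in> carrier H \<Longrightarrow> antipode H h \<in> carrier H"
  using antipode_linear by (rule linear_mapD)

lemma sweedler_cong:
  "\<lbrakk>h \<in> carrier H; \<And>a b. a \<in> carrier H \<Longrightarrow> b \<in> carrier H \<Longrightarrow> \<beta> a b = \<gamma> a b\<rbrakk>
    \<Longrightarrow> sweedler H P \<beta> h = sweedler H P \<gamma> h"
  unfolding sweedler_def tensor_lift_eq by (rule tensor_sum_cong[OF comult_rep])

lemma sweedler_closed_ops:
  assumes "h \<in> carrier H" "closed_ops K P"
    and "\<And>a b. a \<in> carrier H \<Longrightarrow> b \<in> carrier H \<Longrightarrow> \<beta> a b \<in> carrier P"
  shows "sweedler H P \<beta> h \<in> carrier P"
  unfolding sweedler_def tensor_lift_eq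
  using closed_ops.zero_mem[OF assms(2)] closed_ops.add_mem[OF assms(2)] assms(3)
  by (rule tensor_sum_closed[OF comult_rep[OF assms(1)], rotated]) auto

lemma sweedler_image:
  assumes "h \<in> carrier H" "closed_ops K P"
    and "\<And>a b. a \<in> carrier H \<Longrightarrow> b \<in> carrier H \<Longrightarrow> \<beta> a b \<in> carrier P"
    and "f \<zero>\<^bsub>P\<^esub> = \<zero>\<^bsub>Q\<^esub>"
    and "\<And>x y. x \<in> carrier P \<Longrightarrow> y \<in> carrier P \<Longrightarrow> f (x \<oplus>\<^bsub>P\<^esub> y) = f x \<oplus>\<^bsub>Q\<^esub> f y"
  shows "f (sweedler H P \<beta> h) = sweedler H Q (\<lambda>a b. f (\<beta> a b)) h"
  unfolding sweedler_def tensor_lift_eq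
  using tensor_sum_image[where P = P and Q = Q and \<beta> = \<beta> and f = f, OF comult_rep[OF assms(1)] assms(3)
      closed_ops.zero_mem[OF assms(2)] closed_ops.add_mem[OF assms(2)] assms(4,5)]
  by blast

lemma sweedler_linear_image:
  assumes "h \<in> carrier H" "module K P" "module K Q" "linear_map K P Q f"
    and "\<And>a b. a \<in> carrier H \<Longrightarrow> b \<in> carrier H \<Longrightarrow> \<beta> a b \<in> carrier P"
  shows "f (sweedler H P \<beta> h) = sweedler H Q (\<lambda>a b. f (\<beta> a b)) h"
proof (rule sweedler_image)
  interpret P: module K P by fact
  interpret Q: module K Q by fact
  show "closed_ops K P" by (rule P.closed_ops)
  show "f \<zero>\<^bsub>P\<^esub> = \<zero>\<^bsub>Q\<^esub>"
    using linear_mapD[OF assms(4)] by (intro P.additive_zero[OF Q.abelian_group_axioms])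
qed (use assms linear_mapD[OF assms(4)] in auto)

text \<open>The axiom \<open>coassoc\<close> is an identity in H \<otimes> (H \<otimes> H). A
  trilinear \<open>T\<close> induces an additive map from there to \<open>P\<close>, and applying
  this map to both sides of the axiom yields the two iterated sums.\<close>

lemma sweedler_coassoc:
  assumes "abelian_group P" and h: "h \<in> carrier H"
    and T_closed: "\<And>x y z. \<lbrakk>x \<in> carrier H; y \<in> carrier H; z \<in> carrier H\<rbrakk> \<Longrightarrow> T x y z \<in> carrier P"
    and T_add1: "\<And>x x' y z. \<lbrakk>x \<in> carrier H; x' \<in> carrier H; y \<in> carrier H; z \<in> carrier H\<rbrakk>
      \<Longrightarrow> T (x \<oplus>\<^bsub>H\<^esub> x') y z = T x y z \<oplus>\<^bsub>P\<^esub> T x' y z"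
    and T_add2: "\<And>x y y' z. \<lbrakk>x \<in> carrier H; y \<in> carrier H; y' \<in> carrier H; z \<in> carrier H\<rbrakk>
      \<Longrightarrow> T x (y \<oplus>\<^bsub>H\<^esub> y') z = T x y z \<oplus>\<^bsub>P\<^esub> T x y' z"
    and T_add3: "\<And>x y z z'. \<lbrakk>x \<in> carrier H; y \<in> carrier H; z \<in> carrier H; z' \<in> carrier H\<rbrakk>
      \<Longrightarrow> T x y (z \<oplus>\<^bsub>H\<^esub> z') = T x y z \<oplus>\<^bsub>P\<^esub> T x y z'"
    and T_balanced12: "\<And>k x y z. \<lbrakk>k \<in> carrier K; x \<in> carrier H; y \<in> carrier H; z \<in> carrier H\<rbrakk>
      \<Longrightarrow> T (k \<odot>\<^bsub>H\<^esub> x) y z = T x (k \<odot>\<^bsub>H\<^esub> y) z"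
    and T_balanced23: "\<And>k x y z. \<lbrakk>k \<in> carrier K; x \<in> carrier H; y \<in> carrier H; z \<in> carrier H\<rbrakk>
      \<Longrightarrow> T x (k \<odot>\<^bsub>H\<^esub> y) z = T x y (k \<odot>\<^bsub>H\<^esub> z)"
  shows "sweedler H P (\<lambda>a b. sweedler H P (\<lambda>c d. T c d b) a) h
    = sweedler H P (\<lambda>a b. sweedler H P (\<lambda>c d. T a c d) b) h"
proof -
  interpret P: abelian_group P by fact
  let ?HH = "tensor K H H"
  let ?HHH = "tensor K H ?HH"
  \<comment> \<open>Lifting in two stages: \<open>\<beta> x\<close> is the map on H \<otimes> H
    induced by \<open>T x\<close>. Once \<beta> is known to be balanced on H and H \<otimes> H, its
    own lift is the desired map on the triple tensor product.\<close>
  define \<beta> where "\<beta> = (\<lambda>x. tensor_lift P (T x))"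
  have HH: "closed_ops K ?HH" and HHH: "closed_ops K ?HHH"
    by (intro closed_ops_tensor H_closed_ops)+
  have inner: "balanced_map K H H P (T x)" if x: "x \<in> carrier H" for x
  proof (intro balanced_map.intro balanced_map_axioms.intro H_closed_ops \<open>abelian_group P\<close>)
    fix z assume "z \<in> carrier H"
    then show "T x \<zero>\<^bsub>H\<^esub> z = \<zero>\<^bsub>P\<^esub>"
      using H.additive_zero[OF \<open>abelian_group P\<close>, of "\<lambda>y. T x y z"] x T_closed T_add2 by simp
  qed (use x T_closed T_add2 T_add3 T_balanced23 in auto)
  have \<beta>_closed: "\<beta> x u \<in> carrier P" if "x \<in> carrier H" "u \<in> carrier ?HH" for x u
    unfolding \<beta>_def using balanced_map.lift_closed[OF inner] that by blast
  have \<beta>_add: "\<beta> (x \<oplus>\<^bsub>H\<^esub> x') u = \<beta> x u \<oplus>\<^bsub>P\<^esub> \<beta> x' u"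
    if "x \<in> carrier H" "x' \<in> carrier H" "u \<in> carrier ?HH" for x x' u
  proof -
    have u: "set (tensor_rep u) \<subseteq> carrier H \<times> carrier H"
      using that(3) by (rule tensor_rep_carrier[OF H_closed_ops H_closed_ops])
    \<comment> \<open>The representative of \<open>u\<close> depends on \<open>u\<close> alone, so
      all three values are sums over the same list.\<close>
    have "\<beta> (x \<oplus>\<^bsub>H\<^esub> x') u = tensor_sum P (\<lambda>v w. T x v w \<oplus>\<^bsub>P\<^esub> T x' v w) (tensor_rep u)"
      unfolding \<beta>_def tensor_lift_eq using that by (intro tensor_sum_cong[OF u]) (simp add: T_add1)
    also have "\<dots> = \<beta> x u \<oplus>\<^bsub>P\<^esub> \<beta> x' u"
      unfolding \<beta>_def tensor_lift_eq using that by (intro P.tensor_sum_add[OF u]) (simp_all add: T_closed)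
    finally show ?thesis .
  qed
  have \<beta>_balanced: "\<beta> (k \<odot>\<^bsub>H\<^esub> x) u = \<beta> x (k \<odot>\<^bsub>?HH\<^esub> u)"
    if "k \<in> carrier K" "x \<in> carrier H" "u \<in> carrier ?HH" for k x u
  proof -
    have u: "set (tensor_rep u) \<subseteq> carrier H \<times> carrier H"
      using that(3) by (rule tensor_rep_carrier[OF H_closed_ops H_closed_ops])
    \<comment> \<open>\<open>lift_smult\<close> puts the scalar on the second variable of
      \<open>T\<close>, and \<open>T_balanced12\<close> carries it to the first.\<close>
    have "\<beta> x (k \<odot>\<^bsub>?HH\<^esub> u) = tensor_lift P (\<lambda>v w. T x (k \<odot>\<^bsub>H\<^esub> v) w) u"
      unfolding \<beta>_def using that by (intro balanced_map.lift_smult inner)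
    also have "\<dots> = \<beta> (k \<odot>\<^bsub>H\<^esub> x) u"
      unfolding \<beta>_def tensor_lift_eq using that
      by (intro tensor_sum_cong[OF u]) (simp add: T_balanced12)
    finally show ?thesis by simp
  qed
  interpret outer: balanced_map K H ?HH P \<beta>
  proof (intro balanced_map.intro balanced_map_axioms.intro H_closed_ops HH \<open>abelian_group P\<close>)
    fix u assume "u \<in> carrier ?HH"
    then show "\<beta> \<zero>\<^bsub>H\<^esub> u = \<zero>\<^bsub>P\<^esub>"
      using H.additive_zero[OF \<open>abelian_group P\<close>, of "\<lambda>x. \<beta> x u"] \<beta>_closed \<beta>_add by simp
  next
    fix x u u' assume "x \<in> carrier H" "u \<in> carrier ?HH" "u' \<in> carrier ?HH"
    then show "\<beta> x (u \<oplus>\<^bsub>?HH\<^esub> u') = \<beta> x u \<oplus>\<^bsub>P\<^esub> \<beta> x u'"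
      unfolding \<beta>_def by (intro balanced_map.lift_add inner)
  qed (use \<beta>_closed \<beta>_add \<beta>_balanced in auto)
  have \<beta>_pure: "\<beta> x (pure_tensor K H H y z) = T x y z"
    if "x \<in> carrier H" "y \<in> carrier H" "z \<in> carrier H" for x y z
    unfolding \<beta>_def using that by (intro balanced_map.lift_pure inner)
  note closed = pure_tensor_closed comult_closed sweedler_closed_ops HHH
  \<comment> \<open>The lift of \<beta> preserves zero and sums, so it commutes with Sweedler sums
    formed in the triple tensor product.\<close>
  note image = sweedler_image[where f = "tensor_lift P \<beta>", OF _ HHH _ outer.lift_zero outer.lift_add]
  have "sweedler H P (\<lambda>a b. sweedler H P (\<lambda>c d. T c d b) a) h
    = sweedler H P (\<lambda>a b. tensor_lift P \<beta> (sweedler H ?HHH (\<lambda>c d.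
        pure_tensor K H ?HH c (pure_tensor K H H d b)) a)) h"
  proof (rule sweedler_cong[OF h])
    fix a b assume a: "a \<in> carrier H" and b: "b \<in> carrier H"
    have "tensor_lift P \<beta> (sweedler H ?HHH (\<lambda>c d. pure_tensor K H ?HH c (pure_tensor K H H d b)) a)
        = sweedler H P (\<lambda>c d. tensor_lift P \<beta> (pure_tensor K H ?HH c (pure_tensor K H H d b))) a"
      using a b by (intro image) (simp_all add: closed)
    also have "\<dots> = sweedler H P (\<lambda>c d. T c d b) a"
      using b by (intro sweedler_cong[OF a]) (simp add: outer.lift_pure \<beta>_pure closed)
    finally show "sweedler H P (\<lambda>c d. T c d b) a = tensor_lift P \<beta> (sweedler H ?HHH (\<lambda>c d.
        pure_tensor K H ?HH c (pure_tensor K H H d b)) a)" by simp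
  qed
  also have "\<dots> = tensor_lift P \<beta> (sweedler H ?HHH (\<lambda>a b. sweedler H ?HHH (\<lambda>c d.
        pure_tensor K H ?HH c (pure_tensor K H H d b)) a) h)"
    using h by (intro image[symmetric]) (simp_all add: closed)
  also have "\<dots> = tensor_lift P \<beta> (sweedler H ?HHH (\<lambda>a b. pure_tensor K H ?HH a (comult H b)) h)"
    by (simp only: coassoc[OF h])
  also have "\<dots> = sweedler H P (\<lambda>a b. tensor_lift P \<beta> (pure_tensor K H ?HH a (comult H b))) h"
    using h by (intro image) (simp_all add: closed)
  \<comment> \<open>The lift sends the pure tensor to \<open>\<beta> a (comult H b)\<close>, which
    is by definition the Sweedler sum of \<open>T a\<close> at \<open>b\<close>.\<close>
  also have "\<dots> = sweedler H P (\<lambda>a b. sweedler H P (\<lambda>c d. T a c d) b) h"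
    by (intro sweedler_cong[OF h]) (simp add: outer.lift_pure closed, simp add: \<beta>_def sweedler_def)
  finally show ?thesis .
qed


section \<open>H-linearity and invariance at a single object\<close>

section \<open>Invariant linear maps\<close>

text \<open>With \<open>V\<close> and \<open>W\<close> the values of two equivariant modules at an
  object, the second condition is invariance under the action of \<open>Mod_H\<close>, read off at
  that object.\<close>

lemma H_linear_iff_invariant:
  assumes "left_H_module K H V act" and "left_H_module K H W act'" and f: "linear_map K V W f"
  shows "(\<forall>h\<in>carrier H. \<forall>m\<in>carrier V. f (act h m) = act' h (f m)) \<longleftrightarrow>
    (\<forall>h\<in>carrier H. \<forall>m\<in>carrier V.
      sweedler H W (\<lambda>a b. act' a (f (act (antipode H b) m))) h = counit H h \<odot>\<^bsub>W\<^esub> f m)"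
    (is "?linear \<longleftrightarrow> ?invariant")
proof -
  interpret V: left_H_module K H V act by fact
  interpret W: left_H_module K H W act' by fact
  note f_simps = linear_mapD[OF f]
  note S_simps = linear_mapD[OF antipode_linear]
  note V_simps = linear_mapD[OF V.act_linear] linear_mapD[OF V.act_linear_left]
  note W_simps = linear_mapD[OF W.act_linear] linear_mapD[OF W.act_linear_left]
  note modules = module_axioms V.module_axioms W.module_axioms
  show ?thesis
  proof
    assume linear: ?linear
    show ?invariant
    proof (intro ballI)
      fix h m assume h: "h \<in> carrier H" and m: "m \<in> carrier V"
      \<comment> \<open>Linearity pulls \<open>antipode H b\<close> out of \<open>f\<close>. The two
        actions on \<open>W\<close> then merge into that of one product, to which
        \<open>antipode_right\<close> applies.\<close>
      have "sweedler H W (\<lambda>a b. act' a (f (act (antipode H b) m))) h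
          = sweedler H W (\<lambda>a b. act' (a \<otimes>\<^bsub>H\<^esub> antipode H b) (f m)) h"
        using linear m by (intro sweedler_cong[OF h]) (simp add: W.act_mult f_simps S_simps)
      also have "\<dots> = act' (sweedler H H (\<lambda>a b. a \<otimes>\<^bsub>H\<^esub> antipode H b) h) (f m)"
        using h m modules
        by (intro sweedler_linear_image[symmetric, where f = "\<lambda>x. act' x (f m)"] W.act_linear_left)
          (simp_all add: f_simps S_simps)
      also have "\<dots> = counit H h \<odot>\<^bsub>W\<^esub> f m"
        using h m by (simp add: antipode_right counit_closed f_simps W_simps W.act_one)
      finally show "sweedler H W (\<lambda>a b. act' a (f (act (antipode H b) m))) h
          = counit H h \<odot>\<^bsub>W\<^esub> f m" .
    qed
  next
    assume invariant: ?invariant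
    show ?linear
    proof (intro ballI)
      fix h m assume h: "h \<in> carrier H" and m: "m \<in> carrier V"
      let ?T = "\<lambda>x y z. act' x (f (act (antipode H y) (act z m)))"
      have "act' h (f m) = act' (sweedler H H (\<lambda>a b. counit H b \<odot>\<^bsub>H\<^esub> a) h) (f m)"
        using h by (simp add: counit_right)
      also have "\<dots> = sweedler H W (\<lambda>a b. act' (counit H b \<odot>\<^bsub>H\<^esub> a) (f m)) h"
        using h m modules
        by (intro sweedler_linear_image[where f = "\<lambda>x. act' x (f m)"] W.act_linear_left)
          (simp_all add: f_simps counit_closed)
      also have "\<dots> = sweedler H W (\<lambda>a b. sweedler H W (\<lambda>c d. ?T a c d) b) h"
      proof (rule sweedler_cong[OF h])
        fix a b assume a: "a \<in> carrier H" and b: "b \<in> carrier H"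
        \<comment> \<open>The scalar is moved through \<open>act'\<close>, \<open>f\<close> and
          \<open>act\<close> onto the unit of \<open>H\<close>, so that \<open>antipode_left\<close>
          can expand it into a sum over \<open>b\<close>.\<close>
        have "act' (counit H b \<odot>\<^bsub>H\<^esub> a) (f m) = act' a (f (act (counit H b \<odot>\<^bsub>H\<^esub> \<one>\<^bsub>H\<^esub>) m))"
          using a b m by (simp add: counit_closed f_simps V_simps W_simps V.act_one)
        also have "\<dots> = act' a (f (act (sweedler H H (\<lambda>c d. antipode H c \<otimes>\<^bsub>H\<^esub> d) b) m))"
          using b by (simp add: antipode_left)
        also have "\<dots> = sweedler H W (\<lambda>c d. act' a (f (act (antipode H c \<otimes>\<^bsub>H\<^esub> d) m))) b"
        proof (rule sweedler_linear_image[OF b modules(1,3), where f = "\<lambda>x. act' a (f (act x m))"])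
          show "linear_map K H W (\<lambda>x. act' a (f (act x m)))"
            using a m by (simp add: linear_map_def f_simps V_simps W_simps)
        qed (simp add: S_simps)
        also have "\<dots> = sweedler H W (\<lambda>c d. ?T a c d) b"
          using m by (intro sweedler_cong[OF b]) (simp add: V.act_mult S_simps)
        finally show "act' (counit H b \<odot>\<^bsub>H\<^esub> a) (f m) = sweedler H W (\<lambda>c d. ?T a c d) b" .
      qed
      \<comment> \<open>Regrouping leaves the factor acting on \<open>m\<close> first in the outer
        sum, and the pair forming the action on \<open>f\<close> in the inner one.\<close>
      also have "\<dots> = sweedler H W (\<lambda>a b. sweedler H W (\<lambda>c d. ?T c d b) a) h"
        using m by (intro sweedler_coassoc[symmetric] W.abelian_group_axioms h)
          (simp_all add: f_simps S_simps V_simps W_simps)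
      \<comment> \<open>Invariance is used for \<open>a\<close> at the vector \<open>act b m\<close>
        in place of \<open>m\<close>. The resulting scalar is then moved inside \<open>f\<close>
        onto \<open>b\<close>, ready for \<open>counit_left\<close>.\<close>
      also have "\<dots> = sweedler H W (\<lambda>a b. f (act (counit H a \<odot>\<^bsub>H\<^esub> b) m)) h"
        using invariant m
        by (intro sweedler_cong[OF h]) (simp add: counit_closed f_simps V_simps)
      also have "\<dots> = f (act (sweedler H H (\<lambda>a b. counit H a \<odot>\<^bsub>H\<^esub> b) h) m)"
      proof (rule sweedler_linear_image[OF h modules(1,3), where f = "\<lambda>x. f (act x m)", symmetric])
        show "linear_map K H W (\<lambda>x. f (act x m))"
          using m by (simp add: linear_map_def f_simps V_simps)
      qed (simp add: counit_closed)
      also have "\<dots> = f (act h m)"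
        using h by (simp add: counit_left)
      finally show "f (act h m) = act' h (f m)" by simp
    qed
  qed
qed

end

section \<open>From single objects to module morphisms and to the categories\<close>

lemma morphism_invariant_iff:
  assumes "hopf_algebra K H" and M: "equivariant_module K H C M" and N: "equivariant_module K H C N"
    and \<eta>: "\<eta> \<in> right_module_morphisms K C M N"
  shows "(\<forall>h\<in>carrier H. Act (Mod_H K H C) M N h \<eta> = counit H h \<odot>\<^bsub>right_module_Hom K C M N\<^esub> \<eta>) \<longleftrightarrow>
    (\<forall>X\<in>Obj C. \<forall>h\<in>carrier H. \<forall>m\<in>carrier (FObj M X). \<eta> X (HAct M X h m) = HAct N X h (\<eta> X m))"
proof -
  interpret hopf_algebra K H by fact
  \<comment> \<open>Both sides of the invariance equation are restricted to \<open>Obj C\<close> and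
    to the carriers of \<open>M\<close>, so they agree outside these sets and can be compared
    pointwise inside.\<close>
  have "(\<forall>h\<in>carrier H. Act (Mod_H K H C) M N h \<eta> = counit H h \<odot>\<^bsub>right_module_Hom K C M N\<^esub> \<eta>) \<longleftrightarrow>
      (\<forall>X\<in>Obj C. \<forall>h\<in>carrier H. \<forall>m\<in>carrier (FObj M X).
        sweedler H (FObj N X) (\<lambda>a b. HAct N X a (\<eta> X (HAct M X (antipode H b) m))) h
          = counit H h \<odot>\<^bsub>FObj N X\<^esub> \<eta> X m)"
    by (auto simp: Mod_H_def right_module_Hom_def linear_Hom_def restrict_def fun_eq_iff)
  also have "\<dots> \<longleftrightarrow> (\<forall>X\<in>Obj C. \<forall>h\<in>carrier H. \<forall>m\<in>carrier (FObj M X).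
      \<eta> X (HAct M X h m) = HAct N X h (\<eta> X m))"
  proof (rule ball_cong[OF HOL.refl])
    fix X assume X: "X \<in> Obj C"
    have "linear_map K (FObj M X) (FObj N X) (\<eta> X)"
      using \<eta> X by (auto simp: right_module_morphisms_def linear_Hom_def)
    from H_linear_iff_invariant[OF equivariant_module.HAct_module[OF M X]
        equivariant_module.HAct_module[OF N X] this]
    show "(\<forall>h\<in>carrier H. \<forall>m\<in>carrier (FObj M X).
        sweedler H (FObj N X) (\<lambda>a b. HAct N X a (\<eta> X (HAct M X (antipode H b) m))) h
          = counit H h \<odot>\<^bsub>FObj N X\<^esub> \<eta> X m) \<longleftrightarrow>
      (\<forall>h\<in>carrier H. \<forall>m\<in>carrier (FObj M X). \<eta> X (HAct M X h m) = HAct N X h (\<eta> X m))" by simp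
  qed
  finally show ?thesis .
qed

theorem proposition3p4:
  fixes K :: "('k, 'r) ring_scheme"
    and H :: "('k, 'h, 'a) hopf_algebra_scheme"
    and C :: "('k, 'h, 'o, 'm, 'b) hmodcat_scheme"
  assumes "hopf_algebra K H"
    and "left_H_category K H C"
  shows "identical_categories K
    (Mod_HH K H C :: ('k, ('k, 'h, 'o, 'm, 'v) eqmod, 'o \<Rightarrow> 'v \<Rightarrow> 'v) lincat)
    (invariants H (Mod_H K H C))"
proof -
  \<comment> \<open>Both sides are \<open>right_module_Hom K C M N\<close> with its carrier
    replaced, so equal carriers give equal records. Objects, composition and identities agree by
    definition.\<close>
  have "Hom (Mod_HH K H C) M N = Hom (invariants H (Mod_H K H C)) M N"
    if "equivariant_module K H C M" "equivariant_module K H C N"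
    for M N :: "('k, 'h, 'o, 'm, 'v) eqmod"
  proof -
    have "{\<eta> \<in> carrier (right_module_Hom K C M N). \<forall>h\<in>carrier H.
          Act (Mod_H K H C) M N h \<eta> = counit H h \<odot>\<^bsub>right_module_Hom K C M N\<^esub> \<eta>}
        = {\<eta> \<in> right_module_morphisms K C M N. \<forall>X\<in>Obj C. \<forall>h\<in>carrier H.
          \<forall>m\<in>carrier (FObj M X). \<eta> X (HAct M X h m) = HAct N X h (\<eta> X m)}"
      using morphism_invariant_iff[OF assms(1) that] by (auto simp: right_module_Hom_def)
    moreover have "Hom (Mod_H K H C) M N = right_module_Hom K C M N"
      by (simp add: Mod_H_def)
    ultimately show ?thesis
      by (simp add: invariants_def Mod_HH_def)
  qed
  then show ?thesis
    by (simp add: identical_categories_def identical_modules_def)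
      (simp add: invariants_def Mod_H_def Mod_HH_def)
qed

end
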